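(* For positive integers $l\le m\le n$, $$\Big\lceil\frac{lm+ln+mn}{2(l+m+n)-2}\Big\rceil \le \theta(K_{l,m,n}\times K_2)\le 2\,\theta(K_{m,n}).$$
   Context: The thickness $\theta(G)$ of a graph $G$ is the minimum number of planar subgraphs whose union is $G$. The Kronecker product $G\times H$ of graphs $G$ and $H$ is the graph with vertex set $V(G)\times V(H)$ in which $(g,h)$ and $(g',h')$ are adjacent if and only if $gg'\in E(G)$ and $hh'\in E(H)$. $K_{l,m,n}$ denotes the complete tripartite graph with parts of sizes $l,m,n$, and $K_{m,n}$ the complete bipartite graph with parts of sizes $m,n$. *)

theory Defs
  imports "HOL-Analysis.Analysis"
begin

text \<open>A (finite, simple, undirected) graph is a pair (V, E) where E is a set of
  two-element subsets of V.\<close>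

type_synonym 'a graph = "'a set \<times> 'a set set"

definition verts :: "'a graph \<Rightarrow> 'a set" where "verts G = fst G"
definition edges :: "'a graph \<Rightarrow> 'a set set" where "edges G = snd G"

definition planar :: "'a graph \<Rightarrow> bool" where
  "planar G \<longleftrightarrow>
     (\<exists>(p :: 'a \<Rightarrow> complex) (\<gamma> :: 'a set \<Rightarrow> real \<Rightarrow> complex).
        inj_on p (verts G) \<and>
        (\<forall>e\<in>edges G. \<exists>u v. e = {u, v} \<and> u \<noteq> v \<and> u \<in> verts G \<and> v \<in> verts G \<and>
            arc (\<gamma> e) \<and> pathstart (\<gamma> e) = p u \<and> pathfinish (\<gamma> e) = p v \<and>
            path_image (\<gamma> e) \<inter> p ` verts G = {p u, p v}) \<and>
        (\<forall>e\<in>edges G. \<forall>e'\<in>edges G. e \<noteq> e' \<longrightarrow>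
            path_image (\<gamma> e) \<inter> path_image (\<gamma> e') \<subseteq> p ` (e \<inter> e')))"

definition thickness :: "'a graph \<Rightarrow> nat" where
  "thickness G = (LEAST k. \<exists>Es :: nat \<Rightarrow> 'a set set.
      (\<Union>i<k. Es i) = edges G \<and> (\<forall>i<k. planar (verts G, Es i)))"

definition kron :: "'a graph \<Rightarrow> 'b graph \<Rightarrow> ('a \<times> 'b) graph" where
  "kron G H = (verts G \<times> verts H,
     {{(g, h), (g', h')} | g h g' h'. {g, g'} \<in> edges G \<and> {h, h'} \<in> edges H})"

text \<open>Complete tripartite graph K_{l,m,n}: vertex (i, j) is the j-th vertex of part i.\<close>

definition K3part :: "nat \<Rightarrow> nat \<Rightarrow> nat \<Rightarrow> (nat \<times> nat) graph" where
  "K3part l m n =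
     (let V = {(i, j). (i = 0 \<and> j < l) \<or> (i = 1 \<and> j < m) \<or> (i = 2 \<and> j < n)}
      in (V, {{x, y} | x y. x \<in> V \<and> y \<in> V \<and> fst x \<noteq> fst y}))"

definition K2part :: "nat \<Rightarrow> nat \<Rightarrow> (nat \<times> nat) graph" where
  "K2part m n =
     (let V = {(i, j). (i = 0 \<and> j < m) \<or> (i = 1 \<and> j < n)}
      in (V, {{x, y} | x y. x \<in> V \<and> y \<in> V \<and> fst x \<noteq> fst y}))"

definition K2 :: "nat graph" where
  "K2 = ({0, 1}, {{0, 1}})"

end

theory Submission
  imports Defs
begin

text \<open>
  The lower bound is the estimate \<open>E \<le> 2 V - 4\<close> for bipartite plane graphs. Let a drawing have \<open>F\<close>
  faces and \<open>C\<close> components. Add the edges one at a time. If the ends of the new arc lie in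
  different components of the drawing, then by Janiszewski's theorem no face is split; otherwise the
  arc closes up to a Jordan curve that meets the old drawing in a connected set, and
  Janiszewski's theorem shows that exactly one face is split, into exactly two. Hence
  \<open>V - E + F \<ge> 1 + C\<close>, and every edge borders at most two faces. If there are at least two
  faces, the edges bordering a face separate the plane, so they are not a forest and there are at
  least four of them.

  For the upper bound, the product is the union of two subgraphs, each of which consists of three
  disjoint complete bipartite graphs that embed into \<open>K\<^bsub>m,n\<^esub>\<close>; drawings of disjoint graphs can be
  placed side by side.
\<close>

section \<open>Attaching an arc to a plane set\<close>

text \<open>Each component of \<open>A\<close> lies in exactly one component of \<open>B\<close>.
  The resulting map is onto because every component of \<open>B\<close> meets \<open>A\<close>, and
  it fails to be injective as soon as \<open>B\<close> joins two points that \<open>A\<close>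
  separates.\<close>

lemma card_components_mono:
  fixes A B :: "'a::topological_space set"
  assumes "A \<subseteq> B" and meet: "\<And>C. C \<in> components B \<Longrightarrow> C \<inter> A \<noteq> {}"
    and fin: "finite (components A)"
  shows "finite (components B)" "card (components B) \<le> card (components A)"
    and "\<And>x y. \<lbrakk>x \<in> A; y \<in> A; connected_component B x y; \<not> connected_component A x y\<rbrakk>
      \<Longrightarrow> card (components B) < card (components A)"
proof -
  \<comment> \<open>The representative of \<open>D\<close> is arbitrary: all points of
    \<open>D\<close> lie in the same component of \<open>B\<close>.\<close>
  define h where "h D = connected_component_set B (SOME x. x \<in> D)" for D
  have h: "h (connected_component_set A x) = connected_component_set B x" if "x \<in> A" for x
  proof -
    have "(SOME y. y \<in> connected_component_set A x) \<in> connected_component_set A x"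
      by (rule someI[of _ x]) (use that in simp)
    then have "connected_component B x (SOME y. y \<in> connected_component_set A x)"
      using connected_component_of_subset \<open>A \<subseteq> B\<close> by fastforce
    then show ?thesis
      unfolding h_def by (metis connected_component_eq mem_Collect_eq)
  qed
  have "components B \<subseteq> h ` components A"
  proof
    fix C assume C: "C \<in> components B"
    then obtain x where x: "x \<in> C" "x \<in> A" using meet by blast
    then have "C = connected_component_set B x"
      using C \<open>A \<subseteq> B\<close> by (metis componentsE connected_component_eq)
    then show "C \<in> h ` components A"
      using h[OF x(2)] x(2) by (metis componentsI imageI)
  qed
  moreover have "h ` components A \<subseteq> components B"
  proof clarify
    fix D assume "D \<in> components A"
    then obtain x where "x \<in> A" "D = connected_component_set A x" by (auto elim: componentsE)
    then show "h D \<in> components B" using h \<open>A \<subseteq> B\<close> by (auto intro: componentsI)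
  qed
  ultimately have eq: "components B = h ` components A" by blast
  show "finite (components B)" "card (components B) \<le> card (components A)"
    using fin by (simp_all add: eq card_image_le)
  fix x y
  assume xy: "x \<in> A" "y \<in> A" "connected_component B x y" "\<not> connected_component A x y"
  have "h (connected_component_set A x) = h (connected_component_set A y)"
    using xy h by (metis connected_component_eq mem_Collect_eq)
  moreover have "connected_component_set A x \<noteq> connected_component_set A y"
    using xy by (metis connected_component_refl_eq mem_Collect_eq)
  ultimately have "\<not> inj_on h (components A)"
    using xy by (metis componentsI inj_onD)
  then show "card (components B) < card (components A)"
    using fin card_image_le[OF fin, of h] unfolding eq
    by (metis eq_card_imp_inj_on le_neq_implies_less)
qed

text \<open>An arc is homeomorphic to an interval, so a nonempty open plane set inside it would
  inject continuously into the line, against invariance of dimension. Hence an added arc never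
  swallows a whole face.\<close>

lemma open_subset_arc_image_empty:
  fixes g :: "real \<Rightarrow> complex"
  assumes "arc g" "open D" "D \<subseteq> path_image g"
  shows "D = {}"
proof (rule ccontr)
  assume "D \<noteq> {}"
  obtain h where h: "homeomorphism {0..1} (path_image g) g h"
    using assms(1) homeomorphism_arc by blast
  have "continuous_on D h" "inj_on h D"
    using h assms(3) unfolding homeomorphism_def
    by (meson continuous_on_subset, metis inj_on_def subsetD)
  then have "DIM(complex) \<le> DIM(real)"
    using invariance_of_dimension assms(2) \<open>D \<noteq> {}\<close> by blast
  then show False by simp
qed

text \<open>A path-connected piece lies entirely inside or entirely outside the path component, so
  both sets are finite unions of compact pieces. This lets an arc between two path components be
  treated as a bridge between disjoint compact sets.\<close>

lemma path_component_clopen_finite_union: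
  fixes \<A> :: "'a::metric_space set set"
  assumes "finite \<A>" "\<And>A. A \<in> \<A> \<Longrightarrow> compact A \<and> path_connected A"
  shows "compact (path_component_set (\<Union>\<A>) x)" "compact (\<Union>\<A> - path_component_set (\<Union>\<A>) x)"
proof -
  let ?P = "path_component_set (\<Union>\<A>) x"
  have sub: "A \<subseteq> ?P" if A: "A \<in> \<A>" "A \<inter> ?P \<noteq> {}" for A
  proof
    fix z assume z: "z \<in> A"
    obtain y where y: "y \<in> A" "path_component (\<Union>\<A>) x y" using A(2) by auto
    have "path_component A y z"
      using assms(2)[OF A(1)] y z by (simp add: path_connected_component)
    then have "path_component (\<Union>\<A>) y z"
      using A(1) by (meson Union_upper path_component_of_subset)
    with y show "z \<in> ?P" using path_component_trans by fastforce
  qed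
  have P: "?P \<subseteq> \<Union>\<A>" by (rule path_component_subset)
  have "?P = \<Union>{A\<in>\<A>. A \<inter> ?P \<noteq> {}}" using sub P by blast
  moreover have "compact (\<Union>{A\<in>\<A>. A \<inter> ?P \<noteq> {}})"
    using assms by (intro compact_Union) auto
  ultimately show "compact ?P" by simp
  have "\<Union>\<A> - ?P = \<Union>{A\<in>\<A>. A \<inter> ?P = {}}" using sub by blast
  moreover have "compact (\<Union>{A\<in>\<A>. A \<inter> ?P = {}})"
    using assms by (intro compact_Union) auto
  ultimately show "compact (\<Union>\<A> - ?P)" by simp
qed

text \<open>Janiszewski's theorem is applied twice: \<open>X\<close> meets the arc in one point, and
  \<open>Y\<close> meets \<open>X\<close> with the arc in one point; both intersections are
  connected. So a bridge splits no face.\<close>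

lemma connected_component_Un_arc_bridge:
  fixes g :: "real \<Rightarrow> complex"
  assumes "compact X" "compact Y" "X \<inter> Y = {}" "arc g"
    and "path_image g \<inter> X = {a}" "path_image g \<inter> Y = {b}"
    and cc: "connected_component (- (X \<union> Y)) x y" and "x \<notin> path_image g" "y \<notin> path_image g"
  shows "connected_component (- (X \<union> Y \<union> path_image g)) x y"
proof -
  have c: "connected_component (- X) x y" "connected_component (- Y) x y"
    by (rule connected_component_of_subset[OF cc], blast)+
  have "connected (- path_image g)" by (simp add: assms connected_arc_complement)
  then have g: "connected_component (- path_image g) x y"
    using assms(8,9) by (simp add: connected_iff_connected_component)
  have "connected_component (- (X \<union> path_image g)) x y"
    using assms(1,4,5) c g
    by (intro Janiszewski) (auto simp: closed_arc_image Int_commute)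
  moreover have "Y \<inter> (X \<union> path_image g) = {b}" using assms(3,6) by blast
  ultimately have "connected_component (- (Y \<union> (X \<union> path_image g))) x y"
    using assms(1,2,4) c
    by (intro Janiszewski[of Y]) (simp_all add: closed_arc_image compact_imp_closed closed_Un del: Compl_Un)
  then show ?thesis by (simp add: Un_ac)
qed

text \<open>The arc \<open>g\<close> and a return arc \<open>h\<close> inside \<open>X\<close> form
  a Jordan curve \<open>J\<close>. Points of one face on the same side of \<open>J\<close> stay
  together, which gives at most two parts; both sides occur near an interior point of
  \<open>g\<close>, which gives at least two.\<close>

lemma connected_component_Un_arc_chord:
  fixes g h :: "real \<Rightarrow> complex"
  assumes X: "compact X" and g: "arc g" "path_image g \<inter> X = {pathstart g, pathfinish g}"
    and h: "arc h" "path_image h \<subseteq> X" "pathstart h = pathfinish g" "pathfinish h = pathstart g"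
  defines "J \<equiv> path_image g \<union> path_image h"
  shows "\<And>x y. \<lbrakk>connected_component (- X) x y; x \<notin> path_image g; y \<notin> path_image g;
      x \<in> inside J \<longleftrightarrow> y \<in> inside J\<rbrakk> \<Longrightarrow> connected_component (- (X \<union> path_image g)) x y"
    and "\<exists>x y. x \<notin> X \<union> path_image g \<and> y \<notin> X \<union> path_image g \<and>
      connected_component (- X) x y \<and> \<not> connected_component (- (X \<union> path_image g)) x y"
proof -
  have J: "J = path_image (g +++ h)" using h by (simp add: J_def path_image_join)
  have sp: "simple_path (g +++ h)"
    using g h by (intro simple_path_join_loop) auto
  note jordan = Jordan_inside_outside[OF sp, folded J]
  have gh: "pathfinish (g +++ h) = pathstart (g +++ h)" using h by simp
  have "compact J" using g h by (simp add: J_def compact_arc_image compact_Un)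
  { fix x y
    assume cc: "connected_component (- X) x y" and n: "x \<notin> path_image g" "y \<notin> path_image g"
      and io: "x \<in> inside J \<longleftrightarrow> y \<in> inside J"
    have "x \<notin> X" "y \<notin> X" using connected_component_in[OF cc] by auto
    then have nJ: "x \<notin> J" "y \<notin> J" using n h by (auto simp: J_def)
    have con: "connected (inside J)" "connected (outside J)" using jordan[OF gh] by simp_all
    have "connected_component (- J) x y"
    proof (cases "x \<in> inside J")
      case True
      then show ?thesis
        using io con(1) inside_no_overlap[of J] unfolding connected_component_def by blast
    next
      case False
      then have "x \<in> outside J" "y \<in> outside J" using io nJ by (auto simp: outside_inside)
      then show ?thesis
        using con(2) outside_no_overlap[of J] unfolding connected_component_def by blast
    qed
    \<comment> \<open>This intersection is an arc, hence connected, as Janiszewski's theorem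
      requires.\<close>
    moreover have "J \<inter> X = path_image h"
      using g h pathfinish_in_path_image[of h] pathstart_in_path_image[of h] unfolding J_def by (simp add: Int_Un_distrib2) blast
    ultimately have "connected_component (- (J \<union> X)) x y"
      using cc \<open>compact J\<close> X h by (intro Janiszewski) (auto simp: compact_imp_closed connected_arc_image)
    moreover have "J \<union> X = X \<union> path_image g" using h by (auto simp: J_def)
    ultimately show "connected_component (- (X \<union> path_image g)) x y" by simp }
  \<comment> \<open>Close to an interior point of \<open>g\<close> there are points on both sides of \<open>J\<close>.\<close>
  obtain z where z: "z \<in> path_image g" "z \<notin> X"
  proof -
    have "infinite (path_image g)" using g(1) arc_image_uncountable uncountable_infinite by blast
    then have "path_image g - {pathstart g, pathfinish g} \<noteq> {}"
      by (metis Diff_eq_empty_iff finite.emptyI finite.insertI finite_subset)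
    then show ?thesis using that g(2) by blast
  qed
  obtain r where r: "r > 0" "ball z r \<subseteq> - X"
    using z(2) X compact_imp_closed by (meson ComplI open_Compl open_contains_ball)
  have "z \<in> frontier (inside J)" "z \<in> frontier (outside J)" using jordan[OF gh] z J_def by auto
  then have "z \<in> closure (inside J)" "z \<in> closure (outside J)" by (auto simp: frontier_def)
  then obtain x y where x: "x \<in> inside J" "x \<in> ball z r" and y: "y \<in> outside J" "y \<in> ball z r"
    using r(1) unfolding closure_approachable mem_ball by (metis dist_commute)
  have nx: "x \<notin> X \<union> path_image g" "y \<notin> X \<union> path_image g"
    using x y r inside_no_overlap[of J] outside_no_overlap[of J] J_def by blast+
  have "connected_component (- X) x y"
    using x y r connected_ball unfolding connected_component_def by blast
  moreover have "\<not> connected_component (- (X \<union> path_image g)) x y"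
  proof
    assume "connected_component (- (X \<union> path_image g)) x y"
    then have "connected_component (- J) x y"
      by (rule connected_component_of_subset) (use h in \<open>auto simp: J_def\<close>)
    then show False using x(1) y(1) inside_same_component[of J x y] inside_Int_outside[of J] by blast
  qed
  ultimately show "\<exists>x y. x \<notin> X \<union> path_image g \<and> y \<notin> X \<union> path_image g \<and>
      connected_component (- X) x y \<and> \<not> connected_component (- (X \<union> path_image g)) x y"
    using nx by blast
qed

text \<open>Within an old face, a new face is determined by one bit: its side of the Jordan curve
  closed up by the arc. If the arc is a bridge there is no curve, and the face is not split at
  all.\<close>

lemma components_Un_arc_fibre:
  fixes g :: "real \<Rightarrow> complex"
  assumes fin: "finite \<A>" "\<And>A. A \<in> \<A> \<Longrightarrow> compact A \<and> path_connected A"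
    and g: "arc g" "path_image g \<inter> \<Union>\<A> = {pathstart g, pathfinish g}"
    and W0: "W0 \<in> components (- \<Union>\<A>)"
  shows "finite {W \<in> components (- (\<Union>\<A> \<union> path_image g)). W \<subseteq> W0} \<and>
      card {W \<in> components (- (\<Union>\<A> \<union> path_image g)). W \<subseteq> W0} \<le> 2"
proof -
  let ?X = "\<Union>\<A>" and ?F = "{W \<in> components (- (\<Union>\<A> \<union> path_image g)). W \<subseteq> W0}"
  have "compact ?X" using fin by (intro compact_Union) auto
  \<comment> \<open>The set \<open>I\<close> carries that bit: the inside of the Jordan curve for a
    chord, and \<open>UNIV\<close>, which distinguishes nothing, for a bridge.\<close>
  have "\<exists>I. \<forall>x y. connected_component (- ?X) x y \<longrightarrow> x \<notin> path_image g \<longrightarrow> y \<notin> path_image g \<longrightarrow>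
      (x \<in> I \<longleftrightarrow> y \<in> I) \<longrightarrow> connected_component (- (?X \<union> path_image g)) x y"
  proof (cases "path_component ?X (pathfinish g) (pathstart g)")
    case True
    then obtain h where h: "arc h" "path_image h \<subseteq> ?X" "pathstart h = pathfinish g" "pathfinish h = pathstart g"
      using path_contains_arc arc_distinct_ends[OF g(1)] unfolding path_component_def
      by (metis subset_trans)
    show ?thesis
      by (intro exI[of _ "inside (path_image g \<union> path_image h)"] allI impI)
        (rule connected_component_Un_arc_chord(1)[OF \<open>compact ?X\<close> g h])
  next
    case False
    let ?P = "path_component_set ?X (pathfinish g)"
    have "pathfinish g \<in> ?X" using g(2) by blast
    then have "pathfinish g \<in> ?P" by (simp add: path_component_refl)
    moreover have "path_image g \<inter> ?P = {pathstart g, pathfinish g} \<inter> ?P"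
      "path_image g \<inter> (?X - ?P) = {pathstart g, pathfinish g} - ?P"
      unfolding g(2)[symmetric] using path_component_subset[of ?X "pathfinish g"] by blast+
    ultimately have meet: "path_image g \<inter> ?P = {pathfinish g}" "path_image g \<inter> (?X - ?P) = {pathstart g}"
      using False by auto
    have X: "?P \<union> (?X - ?P) = ?X"
      using path_component_subset[of ?X "pathfinish g"] by blast
    have disj: "?P \<inter> (?X - ?P) = {}" by blast
    note bridge = connected_component_Un_arc_bridge[OF
        path_component_clopen_finite_union[OF fin, where x="pathfinish g"] disj g(1) meet, unfolded X]
    show ?thesis by (intro exI[of _ UNIV] allI impI) (rule bridge)
  qed
  then obtain I where I: "\<And>x y. \<lbrakk>connected_component (- ?X) x y; x \<notin> path_image g; y \<notin> path_image g;
      x \<in> I \<longleftrightarrow> y \<in> I\<rbrakk> \<Longrightarrow> connected_component (- (?X \<union> path_image g)) x y"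
    by blast
  \<comment> \<open>The bound 2 is the cardinality of \<open>bool\<close>, into which the new faces
    inside \<open>W0\<close> are injected.\<close>
  have inj: "inj_on (\<lambda>W. (SOME x. x \<in> W) \<in> I) ?F"
  proof (rule inj_onI)
    fix W W' assume W: "W \<in> ?F" "W' \<in> ?F"
      and eq: "((SOME x. x \<in> W) \<in> I) = ((SOME x. x \<in> W') \<in> I)"
    let ?x = "SOME x. x \<in> W" and ?y = "SOME x. x \<in> W'"
    have x: "?x \<in> W" "?y \<in> W'"
      using W in_components_nonempty by (auto intro: some_in_eq[THEN iffD2])
    then have "?x \<in> W0" "?y \<in> W0" using W by auto
    then have "connected_component (- ?X) ?x ?y"
      using W0 in_components_connected[OF W0] in_components_subset[OF W0]
      unfolding connected_component_def by blast
    moreover have "W \<subseteq> - (?X \<union> path_image g)" "W' \<subseteq> - (?X \<union> path_image g)"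
      using W in_components_subset by blast+
    ultimately have "connected_component (- (?X \<union> path_image g)) ?x ?y"
      using x eq by (intro I) auto
    then obtain T where "connected T" "T \<subseteq> - (?X \<union> path_image g)" "?x \<in> T" "?y \<in> T"
      unfolding connected_component_def by blast
    then show "W = W'"
      using joinable_components_eq[of T "- (?X \<union> path_image g)" W W'] W x by blast
  qed
  show ?thesis
    using inj card_inj_on_le[OF inj subset_UNIV] inj_on_finite[OF inj subset_UNIV] by simp
qed

lemma finite_components_Un_arc:
  fixes g :: "real \<Rightarrow> complex"
  assumes fin: "finite \<A>" "\<And>A. A \<in> \<A> \<Longrightarrow> compact A \<and> path_connected A"
    and g: "arc g" "path_image g \<inter> \<Union>\<A> = {pathstart g, pathfinish g}"
    and F: "finite (components (- \<Union>\<A>))"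
  shows "finite (components (- (\<Union>\<A> \<union> path_image g)))"
proof -
  have "components (- (\<Union>\<A> \<union> path_image g)) \<subseteq>
    (\<Union>W0 \<in> components (- \<Union>\<A>). {W \<in> components (- (\<Union>\<A> \<union> path_image g)). W \<subseteq> W0})"
  proof
    fix W assume W: "W \<in> components (- (\<Union>\<A> \<union> path_image g))"
    then have "connected W" "W \<subseteq> - \<Union>\<A>" "W \<noteq> {}"
      using in_components_connected in_components_subset in_components_nonempty by blast+
    then obtain W0 where "W0 \<in> components (- \<Union>\<A>)" "W \<subseteq> W0"
      using exists_component_superset[of W "- \<Union>\<A>"] by blast
    with W show "W \<in> (\<Union>W0 \<in> components (- \<Union>\<A>). {W \<in> components (- (\<Union>\<A> \<union> path_image g)). W \<subseteq> W0})"
      by blast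
  qed
  then show ?thesis
    using F components_Un_arc_fibre[OF fin g] by (meson finite_UN_I finite_subset)
qed

text \<open>One step of Euler's formula: an arc attached at its two ends either joins two components of
  the drawing or splits a face.\<close>

lemma euler_step:
  fixes g :: "real \<Rightarrow> complex"
  assumes fin: "finite \<A>" "\<And>A. A \<in> \<A> \<Longrightarrow> compact A \<and> path_connected A"
    and g: "arc g" "path_image g \<inter> \<Union>\<A> = {pathstart g, pathfinish g}"
    and F: "finite (components (- \<Union>\<A>))" and C: "finite (components (\<Union>\<A>))"
  shows "finite (components (\<Union>\<A> \<union> path_image g))"
    and "card (components (- \<Union>\<A>)) + card (components (\<Union>\<A> \<union> path_image g)) + 1
      \<le> card (components (- (\<Union>\<A> \<union> path_image g))) + card (components (\<Union>\<A>))"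
proof -
  let ?X = "\<Union>\<A>" and ?Y = "\<Union>\<A> \<union> path_image g"
  have X: "compact ?X" using fin by (intro compact_Union) auto
  have ends: "pathstart g \<in> ?X" "pathfinish g \<in> ?X" using g by auto
  have meetC: "D \<inter> ?X \<noteq> {}" if D: "D \<in> components ?Y" for D
  proof (cases "D \<inter> path_image g = {}")
    case True
    then show ?thesis using in_components_subset[OF D] in_components_nonempty[OF D] by blast
  next
    case False
    then have "path_image g \<subseteq> D"
      using components_maximal[OF D] g(1) connected_arc_image by blast
    then show ?thesis using ends by auto
  qed
  note monoC = card_components_mono[of ?X ?Y, OF _ meetC C]
  show "finite (components ?Y)" using monoC(1) by blast
  have meetF: "W \<inter> - ?Y \<noteq> {}" if W: "W \<in> components (- ?X)" for W
  proof
    assume "W \<inter> - ?Y = {}"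
    then have "W \<subseteq> path_image g" using in_components_subset[OF W] by blast
    moreover have "open W" using W X by (metis compact_imp_closed open_Compl open_components)
    ultimately show False
      using open_subset_arc_image_empty[OF g(1)] in_components_nonempty[OF W] by blast
  qed
  \<comment> \<open>Here the inclusion runs from the new complement to the old one: removing the arc
    can only merge faces.\<close>
  note monoF = card_components_mono[of "- ?Y" "- ?X", OF _ meetF finite_components_Un_arc[OF fin g F]]
  show "card (components (- ?X)) + card (components ?Y) + 1
      \<le> card (components (- ?Y)) + card (components ?X)"
  proof (cases "path_component ?X (pathfinish g) (pathstart g)")
    case True
    then obtain h where h: "arc h" "path_image h \<subseteq> ?X" "pathstart h = pathfinish g" "pathfinish h = pathstart g"
      using path_contains_arc arc_distinct_ends[OF g(1)] unfolding path_component_def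
      by (metis subset_trans)
    obtain x y where "x \<in> - ?Y" "y \<in> - ?Y"
      "connected_component (- ?X) x y" "\<not> connected_component (- ?Y) x y"
      using connected_component_Un_arc_chord(2)[OF X g h] by blast
    then have "card (components (- ?X)) < card (components (- ?Y))"
      using monoF(3) by blast
    moreover have "card (components ?Y) \<le> card (components ?X)" using monoC(2) by blast
    ultimately show ?thesis by linarith
  next
    case False
    let ?P = "path_component_set ?X (pathfinish g)"
    \<comment> \<open>The path component and its complement in \<open>?X\<close> are both closed, so
      no connected subset of \<open>?X\<close> can meet both.\<close>
    have "\<not> connected_component ?X (pathfinish g) (pathstart g)"
    proof
      assume "connected_component ?X (pathfinish g) (pathstart g)"
      then obtain T where T: "connected T" "T \<subseteq> ?X" "pathfinish g \<in> T" "pathstart g \<in> T"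
        by (auto simp: connected_component_def)
      have "pathfinish g \<in> ?P" using ends by (auto intro: path_component_refl)
      moreover have "closed ?P" "closed (?X - ?P)"
        using path_component_clopen_finite_union[OF fin] compact_imp_closed by blast+
      ultimately show False
        using connected_closedD[OF T(1), of ?P "?X - ?P"] T False by blast
    qed
    moreover have "connected_component ?Y (pathfinish g) (pathstart g)"
      using connected_arc_image[OF g(1)] unfolding connected_component_def by blast
    ultimately have "card (components ?Y) < card (components ?X)"
      using monoC(3) ends by blast
    moreover have "card (components (- ?X)) \<le> card (components (- ?Y))" using monoF(2) by blast
    ultimately show ?thesis by linarith
  qed
qed

section \<open>Plane drawings and Euler's formula\<close>

locale plane_drawing =
  fixes V :: "'a set" and E :: "'a set set" and p :: "'a \<Rightarrow> complex"
    and \<gamma> :: "'a set \<Rightarrow> real \<Rightarrow> complex"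
  assumes finite_V: "finite V" and V_nonempty: "V \<noteq> {}" and inj_p: "inj_on p V"
    and edge: "\<And>e. e \<in> E \<Longrightarrow> \<exists>u v. e = {u, v} \<and> u \<noteq> v \<and> u \<in> V \<and> v \<in> V \<and>
            arc (\<gamma> e) \<and> pathstart (\<gamma> e) = p u \<and> pathfinish (\<gamma> e) = p v \<and>
            path_image (\<gamma> e) \<inter> p ` V = {p u, p v}"
    and crossing: "\<And>e e'. \<lbrakk>e \<in> E; e' \<in> E; e \<noteq> e'\<rbrakk> \<Longrightarrow>
            path_image (\<gamma> e) \<inter> path_image (\<gamma> e') \<subseteq> p ` (e \<inter> e')"
begin

text \<open>This is the finite family of compact path-connected sets that the arc lemmas expect. All
  vertices belong to it for every \<open>S\<close>, so each later arc finds both its ends already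
  drawn.\<close>

definition pieces :: "'a set set \<Rightarrow> complex set set" where
  "pieces S = (\<lambda>v. {p v}) ` V \<union> (\<lambda>e. path_image (\<gamma> e)) ` S"

definition drawn :: "'a set set \<Rightarrow> complex set" where
  "drawn S = \<Union>(pieces S)"

lemma drawn_eq: "drawn S = p ` V \<union> (\<Union>e\<in>S. path_image (\<gamma> e))"
  by (auto simp: drawn_def pieces_def)

lemma drawn_insert: "drawn (insert e S) = drawn S \<union> path_image (\<gamma> e)"
  by (auto simp: drawn_eq)

lemma finite_E: "finite E"
proof -
  have "E \<subseteq> Pow V" using edge by blast
  then show ?thesis using finite_V finite_subset by auto
qed

lemma arc_edge: "e \<in> E \<Longrightarrow> arc (\<gamma> e)"
  using edge by blast

lemma path_image_Int_vertices: "e \<in> E \<Longrightarrow> path_image (\<gamma> e) \<inter> p ` V = p ` e"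
  using edge by fastforce

lemma ends_edge: "e \<in> E \<Longrightarrow> {pathstart (\<gamma> e), pathfinish (\<gamma> e)} = p ` e"
  using edge by fastforce

text \<open>This is the attachment hypothesis of \<open>euler_step\<close>, derived from the rule
  that edges meet only in common vertices.\<close>

lemma path_image_Int_drawn:
  assumes "e \<in> E" "S \<subseteq> E" "e \<notin> S"
  shows "path_image (\<gamma> e) \<inter> drawn S = {pathstart (\<gamma> e), pathfinish (\<gamma> e)}"
proof -
  have "path_image (\<gamma> e) \<inter> path_image (\<gamma> e') \<subseteq> p ` e" if "e' \<in> S" for e'
    using crossing[of e e'] that assms by blast
  then show ?thesis
    unfolding ends_edge[OF assms(1)] drawn_eq using path_image_Int_vertices[OF assms(1)] by blast
qed

lemma finite_pieces: "S \<subseteq> E \<Longrightarrow> finite (pieces S)"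
  unfolding pieces_def using finite_V finite_subset[OF _ finite_E] by auto

lemma pieces_compact_path_connected:
  "\<lbrakk>S \<subseteq> E; A \<in> pieces S\<rbrakk> \<Longrightarrow> compact A \<and> path_connected A"
  unfolding pieces_def
  using arc_edge by (auto simp: compact_arc_image path_connected_path_image arc_imp_path)

lemma compact_drawn: "S \<subseteq> E \<Longrightarrow> compact (drawn S)"
  unfolding drawn_def using finite_pieces pieces_compact_path_connected
  by (intro compact_Union) auto

definition faces :: "'a set set \<Rightarrow> complex set set" where
  "faces S = components (- drawn S)"

lemma faces_empty: "faces {} = {- drawn {}}"
proof -
  have "connected (- p ` V)"
    using path_connected_complement_countable[of "p ` V"] finite_V
    by (simp add: countable_finite path_connected_imp_connected)
  moreover have "- p ` V \<noteq> {}"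
    using finite_V by (metis Compl_empty_eq double_complement finite_imageI infinite_UNIV_char_0)
  ultimately show ?thesis by (simp add: faces_def drawn_eq components_eq_sing_iff)
qed

text \<open>The count starts with one face and one component per vertex; each edge then contributes
  one application of \<open>euler_step\<close>. Only this direction of Euler's formula, a lower
  bound on the number of faces, is wanted.\<close>

lemma euler:
  assumes "S \<subseteq> E"
  shows "finite (faces S) \<and> finite (components (drawn S)) \<and>
    1 + card (components (drawn S)) + card S \<le> card (faces S) + card V"
proof -
  have "finite S" using assms finite_E finite_subset by blast
  then show ?thesis using assms
  proof (induction S)
    case empty
    have "components (p ` V) = (\<lambda>v. {p v}) ` V"
    proof -
      have "connected_component_set (p ` V) (p v) = {p v}" if "v \<in> V" for v
      proof -
        \<comment> \<open>A finite nonempty connected set of points is a singleton.\<close>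
        have "finite (connected_component_set (p ` V) (p v))"
          using finite_V by (meson connected_component_subset finite_imageI finite_subset)
        then show ?thesis
          using that connected_finite_iff_sing[OF connected_connected_component]
          by (metis connected_component_refl_eq empty_iff imageI mem_Collect_eq singletonD)
      qed
      then show ?thesis by (auto simp: components_def image_image)
    qed
    then have "card (components (drawn {})) = card V" "finite (components (drawn {}))"
      using inj_p finite_V by (auto simp: drawn_eq inj_on_def intro!: card_image)
    then show ?case by (simp add: faces_empty)
  next
    case (insert e S)
    then have e: "e \<in> E" "S \<subseteq> E" by auto
    have fin: "finite (pieces S)" "\<And>A. A \<in> pieces S \<Longrightarrow> compact A \<and> path_connected A"
      using finite_pieces pieces_compact_path_connected e(2) by auto
    note g = arc_edge[OF e(1)] path_image_Int_drawn[OF e insert.hyps(2), unfolded drawn_def]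
    have IH: "finite (faces S)" "finite (components (drawn S))"
      "1 + card (components (drawn S)) + card S \<le> card (faces S) + card V"
      using insert.IH e by auto
    have "finite (faces (insert e S))"
      using finite_components_Un_arc[OF fin g, folded drawn_def] IH by (simp add: faces_def drawn_insert)
    moreover have "finite (components (drawn (insert e S)))"
      using euler_step(1)[OF fin g, folded drawn_def] IH by (simp add: faces_def drawn_insert)
    moreover have "card (faces S) + card (components (drawn (insert e S))) + 1
      \<le> card (faces (insert e S)) + card (components (drawn S))"
      using euler_step(2)[OF fin g, folded drawn_def] IH by (simp add: faces_def drawn_insert)
    ultimately show ?case using IH insert.hyps by auto
  qed
qed

section \<open>Incidence of edges and faces\<close>

definition incident :: "'a set \<Rightarrow> complex set \<Rightarrow> bool" where
  "incident e W \<longleftrightarrow> path_image (\<gamma> e) \<inter> closure W - p ` V \<noteq> {}"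

text \<open>Without its ends, \<open>e\<close> lies in a single face \<open>W0\<close> of the
  drawing that omits \<open>e\<close>. Every face incident with \<open>e\<close> must lie in
  \<open>W0\<close>, and adding \<open>e\<close> leaves at most two faces there.\<close>

lemma card_incident_faces:
  assumes "e \<in> E"
  shows "card {W \<in> faces E. incident e W} \<le> 2"
proof -
  let ?S = "E - {e}"
  have S: "?S \<subseteq> E" "e \<notin> ?S" and E: "drawn E = drawn ?S \<union> path_image (\<gamma> e)"
    using assms drawn_insert[of e ?S] by (auto simp: insert_absorb)
  note meet = path_image_Int_drawn[OF assms S]
  have ends: "{pathstart (\<gamma> e), pathfinish (\<gamma> e)} \<subseteq> p ` V"
    using path_image_Int_vertices[OF assms] ends_edge[OF assms] by blast
  have op: "open (- drawn ?S)" using compact_drawn[OF S(1)] compact_imp_closed by blast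
  show ?thesis
  proof (cases "path_image (\<gamma> e) - {pathstart (\<gamma> e), pathfinish (\<gamma> e)} = {}")
    case True
    then have none: "{W \<in> faces E. incident e W} = {}" using ends by (auto simp: incident_def)
    show ?thesis unfolding none by simp
  next
    case False
    have "connected (path_image (\<gamma> e) - {pathstart (\<gamma> e), pathfinish (\<gamma> e)})"
      using arc_edge[OF assms] arc_imp_simple_path connected_simple_path_endless by blast
    moreover have "path_image (\<gamma> e) - {pathstart (\<gamma> e), pathfinish (\<gamma> e)} \<subseteq> - drawn ?S"
      using meet by blast
    ultimately obtain W0 where W0: "W0 \<in> components (- drawn ?S)"
      "path_image (\<gamma> e) - {pathstart (\<gamma> e), pathfinish (\<gamma> e)} \<subseteq> W0"
      using exists_component_superset[of _ "- drawn ?S"] False by blast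
    have "{W \<in> faces E. incident e W} \<subseteq> {W \<in> components (- drawn E). W \<subseteq> W0}"
    proof clarify
      fix W assume W: "W \<in> faces E" "incident e W"
      then have c: "W \<in> components (- drawn E)" by (simp add: faces_def)
      obtain z where z: "z \<in> path_image (\<gamma> e)" "z \<in> closure W" "z \<notin> p ` V"
        using W(2) by (auto simp: incident_def)
      then have "z \<in> W0" using ends W0 by blast
      \<comment> \<open>Openness turns a point of \<open>closure W\<close> in \<open>W0\<close> into
        a point of \<open>W\<close> itself in \<open>W0\<close>.\<close>
      moreover have "open W0" using W0 op open_components by blast
      ultimately have "W \<inter> W0 \<noteq> {}"
        using z(2) by (metis IntI Int_commute empty_iff open_Int_closure_eq_empty)
      moreover have "connected W" "W \<subseteq> - drawn ?S"
        using c E in_components_connected in_components_subset by blast+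
      ultimately have "W \<subseteq> W0" using components_maximal[OF W0(1)] by blast
      with c show "W \<in> components (- drawn E) \<and> W \<subseteq> W0" by simp
    qed
    moreover have "finite {W \<in> components (- drawn E). W \<subseteq> W0} \<and>
        card {W \<in> components (- drawn E). W \<subseteq> W0} \<le> 2"
      using components_Un_arc_fibre[of "pieces ?S" "\<gamma> e" W0, folded drawn_def]
        finite_pieces pieces_compact_path_connected S(1) arc_edge[OF assms] meet W0(1)
      unfolding E by blast
    ultimately show ?thesis by (meson card_mono le_trans)
  qed
qed

text \<open>Since no edge of \<open>T\<close> ends at \<open>v\<close>, the point \<open>p v\<close>
  is isolated in the drawing, and \<open>e\<close> is a bridge from it to the rest. Iterated, this
  shows that a drawn forest does not separate the plane.\<close>

lemma connected_complement_add_leaf: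
  assumes T: "T \<subseteq> E" "e \<in> E" "e \<notin> T" and v: "v \<in> e" "\<And>e'. e' \<in> T \<Longrightarrow> v \<notin> e'"
    and con: "connected (- drawn T)"
  shows "connected (- drawn (insert e T))"
proof -
  obtain w where w: "e = {v, w}" "v \<noteq> w" using edge[OF T(2)] v(1) by blast
  have vw: "v \<in> V" "w \<in> V" using w edge[OF T(2)] by auto
  define X where "X = p ` (V - {v}) \<union> (\<Union>e'\<in>T. path_image (\<gamma> e'))"
  have X: "drawn T = X \<union> {p v}" using vw by (auto simp: drawn_eq X_def)
  have "p v \<notin> path_image (\<gamma> e')" if "e' \<in> T" for e'
  proof
    assume "p v \<in> path_image (\<gamma> e')"
    then have "p v \<in> p ` e'" using path_image_Int_vertices[of e'] that T vw by blast
    moreover have "e' \<subseteq> V" using edge that T by blast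
    ultimately show False using inj_p v(2)[OF that] vw by (metis imageE inj_onD subsetD)
  qed
  then have pv: "p v \<notin> X" using inj_p vw by (auto simp: X_def dest: inj_onD)
  have meet: "path_image (\<gamma> e) \<inter> drawn T = {p v, p w}"
    using path_image_Int_drawn[OF T(2,1,3)] ends_edge[OF T(2)] w by auto
  have "p w \<noteq> p v" using w vw inj_p by (metis inj_onD)
  moreover have "path_image (\<gamma> e) \<inter> X = path_image (\<gamma> e) \<inter> drawn T - {p v}"
    using pv unfolding X by blast
  ultimately have 1: "path_image (\<gamma> e) \<inter> X = {p w}" "path_image (\<gamma> e) \<inter> {p v} = {p v}"
    using meet by auto
  have "compact X" unfolding X_def
    using finite_V finite_subset[OF T(1) finite_E] arc_edge T
    by (intro compact_Un compact_UN) (auto simp: finite_imp_compact compact_arc_image)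
  then have "connected_component (- (X \<union> {p v} \<union> path_image (\<gamma> e))) x y"
    if "x \<in> - drawn (insert e T)" "y \<in> - drawn (insert e T)" for x y
    using that con 1 pv arc_edge[OF T(2)]
    by (intro connected_component_Un_arc_bridge[where a="p w" and b="p v"])
      (auto simp: drawn_insert X[symmetric] connected_iff_connected_component simp del: Un_insert_right)
  then show ?thesis
    by (simp add: connected_iff_connected_component drawn_insert X del: Un_insert_right)
qed

end

section \<open>Bipartite drawings and the edge bound\<close>

locale bipartite_plane_drawing = plane_drawing +
  fixes col :: "'a \<Rightarrow> bool"
  assumes bipartite: "\<And>u v. {u, v} \<in> E \<Longrightarrow> col u \<noteq> col v"
begin

text \<open>Without a leaf, an edge \<open>e\<close> can be continued at both ends and once more at
  the far end of \<open>e1\<close>; this gives four different edges because a bipartite graph has no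
  triangle.\<close>

lemma leaf_exists:
  assumes "T \<subseteq> E" "T \<noteq> {}" "card T \<le> 3"
  obtains e v where "e \<in> T" "v \<in> e" "\<And>e'. e' \<in> T - {e} \<Longrightarrow> v \<notin> e'"
proof (rule ccontr)
  assume "\<not> thesis"
  with that have no: "\<exists>e'\<in>T. e' \<noteq> e \<and> v \<in> e'" if "e \<in> T" "v \<in> e" for e v
    using that by blast
  have two: "\<exists>w. e = {u, w} \<and> col w = (\<not> col u)" if "e \<in> T" "u \<in> e" for e u
  proof -
    obtain a b where ab: "e = {a, b}" using edge \<open>e \<in> T\<close> assms(1) by blast
    then have col: "col a \<noteq> col b" using \<open>e \<in> T\<close> assms(1) bipartite by blast
    from ab \<open>u \<in> e\<close> consider "u = a" | "u = b" by blast
    then show ?thesis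
    proof cases
      case 1 then show ?thesis using ab col by blast
    next
      case 2 then show ?thesis using ab col by (intro exI[of _ a]) blast
    qed
  qed
  obtain e where e: "e \<in> T" using assms by blast
  then obtain u where "u \<in> e" using edge assms by blast
  with e obtain v where v: "e = {u, v}" "col v = (\<not> col u)" using two by blast
  obtain e1 where e1: "e1 \<in> T" "e1 \<noteq> e" "u \<in> e1" using no[OF e, of u] v by blast
  obtain e2 where e2: "e2 \<in> T" "e2 \<noteq> e" "v \<in> e2" using no[OF e, of v] v by blast
  obtain w where w: "e1 = {u, w}" "col w = (\<not> col u)" using two e1 by blast
  obtain w' where w': "e2 = {v, w'}" "col w' = (\<not> col v)" using two e2 by blast
  obtain e3 where e3: "e3 \<in> T" "e3 \<noteq> e1" "w \<in> e3" using no[OF e1(1), of w] w by blast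
  have "w \<noteq> v" using w v e1 by auto
  \<comment> \<open>For \<open>e3\<close> and \<open>e2\<close> the colouring decides: if they
    coincided, \<open>w\<close> and \<open>v\<close> would be adjacent, although both have the
    colour opposite to that of \<open>u\<close>.\<close>
  then have "e1 \<noteq> e2" "e3 \<noteq> e" "e3 \<noteq> e2" using w w' v e3 e1 e2 by auto
  then have "card {e, e1, e2, e3} = 4" using e1 e2 e3 by auto
  moreover have "card {e, e1, e2, e3} \<le> card T"
    using e e1 e2 e3 assms finite_E finite_subset by (intro card_mono) auto
  ultimately show False using assms by simp
qed

text \<open>At most three edges always have a leaf, so they can be stripped one by one down to the
  bare vertices.\<close>

lemma connected_complement_drawn:
  assumes "T \<subseteq> E" "card T \<le> 3"
  shows "connected (- drawn T)"
proof -
  have "finite T" using assms finite_E finite_subset by blast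
  then show ?thesis using assms
  proof (induction T rule: finite_psubset_induct)
    case (psubset T)
    show ?case
    proof (cases "T = {}")
      case True
      then show ?thesis
        using faces_empty in_components_connected[of "- drawn {}" "- drawn {}"] by (simp add: faces_def)
    next
      case False
      then obtain e v where e: "e \<in> T" "v \<in> e" "\<And>e'. e' \<in> T - {e} \<Longrightarrow> v \<notin> e'"
        using leaf_exists psubset.prems by metis
      have "card (T - {e}) \<le> 3" using psubset.prems by (meson Diff_subset card_mono le_trans psubset.hyps)
      then have "connected (- drawn (T - {e}))"
        using psubset e by (intro psubset.IH) auto
      then have "connected (- drawn (insert e (T - {e})))"
        using e psubset.prems by (intro connected_complement_add_leaf) auto
      then show ?thesis using e by (simp add: insert_absorb)
    qed
  qed
qed

text \<open>The frontier of a face lies in the part of the drawing formed by its incident edges, and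
  that part must separate the plane if there are two faces.\<close>

lemma card_incident_edges:
  assumes W: "W \<in> faces E" and two: "card (faces E) \<ge> 2"
  shows "4 \<le> card {e \<in> E. incident e W}"
proof (rule ccontr)
  let ?T = "{e \<in> E. incident e W}"
  assume "\<not> 4 \<le> card ?T"
  then have con: "connected (- drawn ?T)" by (intro connected_complement_drawn) auto
  have c: "W \<in> components (- drawn E)" using W by (simp add: faces_def)
  have sub: "W \<subseteq> - drawn E" "W \<noteq> {}"
    using c in_components_subset in_components_nonempty by blast+
  have "frontier W \<subseteq> drawn E"
    using frontier_of_components_closed_complement[of "drawn E" W] c compact_drawn[of E] compact_imp_closed
    by blast
  \<comment> \<open>A frontier point is either a vertex, which is always drawn, or an interior point
    of an edge that is thereby incident with \<open>W\<close>.\<close>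
  then have "frontier W \<subseteq> drawn ?T"
    by (auto simp: drawn_eq incident_def frontier_def)
  moreover have TE: "drawn ?T \<subseteq> drawn E" by (auto simp: drawn_eq)
  \<comment> \<open>A connected set that meets \<open>W\<close> but not its frontier lies in
    \<open>W\<close>.\<close>
  ultimately have "- drawn ?T \<subseteq> W"
    using connected_Int_frontier[OF con, of W] sub by blast
  then have "- drawn E = W" using TE sub by blast
  then have "faces E = {W}"
    using in_components_connected[OF c] sub by (simp add: faces_def components_eq_sing_iff)
  with two show False by simp
qed

text \<open>Double counting of incidences gives \<open>4 F \<le> 2 E\<close> for \<open>F\<close>
  faces and \<open>E\<close> edges; substituting Euler's lower bound for \<open>F\<close>, with at
  least one component, leaves the claim.\<close>

theorem card_edges_le:
  assumes "card V \<ge> 3"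
  shows "card E + 4 \<le> 2 * card V"
proof -
  have fin: "finite (faces E)" "finite (components (drawn E))"
    and eu: "1 + card (components (drawn E)) + card E \<le> card (faces E) + card V"
    using euler[of E] by auto
  have "drawn E \<noteq> {}" using V_nonempty by (auto simp: drawn_eq)
  then have C: "card (components (drawn E)) \<ge> 1"
    using fin(2) by (simp add: Suc_le_eq card_gt_0_iff components_eq_empty)
  show ?thesis
  proof (cases "card (faces E) \<ge> 2")
    case True
    have "card (faces E) * 4 = (\<Sum>W\<in>faces E. 4)" by simp
    also have "\<dots> \<le> (\<Sum>W\<in>faces E. card {e \<in> E. incident e W})"
      using card_incident_edges[OF _ True] by (rule sum_mono)
    also have "\<dots> = (\<Sum>e\<in>E. card {W \<in> faces E. incident e W})"
      by (rule sum_multicount_gen) (use finite_E fin in auto)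
    also have "\<dots> \<le> (\<Sum>e\<in>E. 2)"
      using card_incident_faces by (rule sum_mono)
    also have "\<dots> = card E * 2" by simp
    finally show ?thesis using eu C by linarith
  next
    \<comment> \<open>With at most one face, Euler's inequality gives at most
      \<open>card V - 1\<close> edges; three vertices make this strong enough.\<close>
    case False
    then show ?thesis using eu C assms by linarith
  qed
qed

end

section \<open>Thickness\<close>

lemma planar_bipartite_card_edges:
  fixes G :: "'a graph"
  assumes "planar G" "finite (verts G)" "card (verts G) \<ge> 3"
    and "\<And>u v. {u, v} \<in> edges G \<Longrightarrow> col u \<noteq> (col v :: bool)"
  shows "card (edges G) + 4 \<le> 2 * card (verts G)"
proof -
  obtain p :: "'a \<Rightarrow> complex" and \<gamma> where d: "inj_on p (verts G)"
    "\<forall>e\<in>edges G. \<exists>u v. e = {u, v} \<and> u \<noteq> v \<and> u \<in> verts G \<and> v \<in> verts G \<and>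
            arc (\<gamma> e) \<and> pathstart (\<gamma> e) = p u \<and> pathfinish (\<gamma> e) = p v \<and>
            path_image (\<gamma> e) \<inter> p ` verts G = {p u, p v}"
    "\<forall>e\<in>edges G. \<forall>e'\<in>edges G. e \<noteq> e' \<longrightarrow>
            path_image (\<gamma> e) \<inter> path_image (\<gamma> e') \<subseteq> p ` (e \<inter> e')"
    using assms(1) unfolding planar_def by blast
  interpret bipartite_plane_drawing "verts G" "edges G" p \<gamma> col
  proof
    show "verts G \<noteq> {}" using assms(3) by auto
  qed (use d assms(2,4) in simp_all)
  show ?thesis using card_edges_le assms(3) by blast
qed

text \<open>Single edges serve as planar layers, which shows that the minimum defining
  \<open>thickness\<close> ranges over a nonempty set.\<close>

lemma planar_single_edge:
  assumes "finite V" "u \<in> V" "v \<in> V" "u \<noteq> v"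
  shows "planar (V, {{u, v}})"
proof -
  obtain f :: "'a \<Rightarrow> nat" where f: "inj_on f V" using finite_imp_inj_to_nat_seg[OF assms(1)] by blast
  \<comment> \<open>The edge becomes the segment from 0 to 1; the shift by 2 keeps all other
    vertices off it.\<close>
  define p :: "'a \<Rightarrow> complex" where
    "p x = (if x = u then 0 else if x = v then 1 else of_nat (f x + 2))" for x
  have p: "p x = of_nat (f x + 2)" if "x \<noteq> u" "x \<noteq> v" for x using that by (simp add: p_def)
  have big: "norm (p x) \<ge> 2" if "x \<noteq> u" "x \<noteq> v" for x
    unfolding p[OF that] norm_of_nat by simp
  have [simp]: "p u = 0" "p v = 1" using assms(4) by (auto simp: p_def)
  have inj: "inj_on p V"
  proof (rule inj_onI)
    fix x y assume xy: "x \<in> V" "y \<in> V" "p x = p y"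
    consider "x \<noteq> u" "x \<noteq> v" "y \<noteq> u" "y \<noteq> v" | "x = u \<or> x = v" | "y = u \<or> y = v" by blast
    then show "x = y"
    proof cases
      case 1
      then have "f x = f y" using xy(3) p by (simp del: of_nat_add)
      then show ?thesis using f xy by (meson inj_onD)
    next
      case 2
      then have "norm (p y) \<le> 1" using xy(3) by auto
      then have "y = u \<or> y = v" using big[of y] by fastforce
      with 2 xy(3) show ?thesis by auto
    next
      case 3
      then have "norm (p x) \<le> 1" using xy(3) by auto
      then have "x = u \<or> x = v" using big[of x] by fastforce
      with 3 xy(3) show ?thesis by auto
    qed
  qed
  have seg: "norm z \<le> 1" if "z \<in> closed_segment 0 (1::complex)" for z
    using segment_bound(1)[OF that] by simp
  have "closed_segment 0 1 \<inter> p ` V = {p u, p v}"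
  proof
    show "closed_segment 0 1 \<inter> p ` V \<subseteq> {p u, p v}"
    proof
      fix z assume "z \<in> closed_segment 0 1 \<inter> p ` V"
      then obtain x where "z = p x" "norm (p x) \<le> 1" using seg by blast
      then show "z \<in> {p u, p v}" using big[of x] by fastforce
    qed
    show "{p u, p v} \<subseteq> closed_segment 0 1 \<inter> p ` V"
      using assms(2,3) imageI[of u V p] imageI[of v V p] by auto
  qed
  then show ?thesis
    unfolding planar_def verts_def edges_def fst_conv snd_conv using inj assms
    by (intro exI[of _ p] exI[of _ "\<lambda>_. linepath 0 1"] conjI ballI exI[of _ u] exI[of _ v])
      simp_all
qed

lemma thickness_le:
  assumes "(\<Union>i<k. Es i) = edges G" "\<And>i. i < k \<Longrightarrow> planar (verts G, Es i)"
  shows "thickness G \<le> k"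
  unfolding thickness_def by (rule Least_le) (use assms in blast)

text \<open>Splitting the graph into its single edges is one admissible decomposition, so the least
  number is attained.\<close>

lemma thickness_decomposition:
  assumes "finite (verts G)"
    and wf: "\<And>e. e \<in> edges G \<Longrightarrow> \<exists>u v. e = {u, v} \<and> u \<noteq> v \<and> u \<in> verts G \<and> v \<in> verts G"
  obtains Es where "(\<Union>i<thickness G. Es i) = edges G"
    "\<And>i. i < thickness G \<Longrightarrow> planar (verts G, Es i)"
proof -
  have "edges G \<subseteq> Pow (verts G)" using wf by blast
  then have "finite (edges G)" using assms(1) finite_subset by auto
  then obtain h where h: "bij_betw h {..<card (edges G)} (edges G)"
    using ex_bij_betw_nat_finite[of "edges G"] by (auto simp: atLeast0LessThan)
  have "(\<Union>i<card (edges G). {h i}) = edges G"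
    using bij_betw_imp_surj_on[OF h] by blast
  moreover have "planar (verts G, {h i})" if "i < card (edges G)" for i
    using wf[of "h i"] planar_single_edge assms(1) bij_betwE[OF h] that by force
  ultimately have "\<exists>(k::nat) Es. (\<Union>i<k. Es i) = edges G \<and> (\<forall>i<k. planar (verts G, Es i))"
    by (intro exI[of _ "card (edges G)"] exI[of _ "\<lambda>i. {h i}"]) blast
  then have "\<exists>Es. (\<Union>i<thickness G. Es i) = edges G \<and> (\<forall>i<thickness G. planar (verts G, Es i))"
    unfolding thickness_def by (rule LeastI_ex)
  then show thesis using that by blast
qed

text \<open>Every layer of an optimal decomposition is a planar bipartite graph on the full vertex
  set, so the edge bound applies to each layer separately.\<close>

lemma bipartite_card_edges_le_thickness:
  assumes fin: "finite (verts G)" "card (verts G) \<ge> 3"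
    and wf: "\<And>e. e \<in> edges G \<Longrightarrow> \<exists>u v. e = {u, v} \<and> u \<noteq> v \<and> u \<in> verts G \<and> v \<in> verts G"
    and col: "\<And>u v. {u, v} \<in> edges G \<Longrightarrow> col u \<noteq> (col v :: bool)"
  shows "card (edges G) \<le> thickness G * (2 * card (verts G) - 4)"
proof -
  obtain Es where Es: "(\<Union>i<thickness G. Es i) = edges G"
    "\<And>i. i < thickness G \<Longrightarrow> planar (verts G, Es i)"
    using thickness_decomposition[OF fin(1) wf] by blast
  have "card (Es i) \<le> 2 * card (verts G) - 4" if "i < thickness G" for i
  proof -
    have "Es i \<subseteq> edges G" using Es(1) that by blast
    then have "card (edges (verts G, Es i)) + 4 \<le> 2 * card (verts (verts G, Es i))"
      using fin col Es(2)[OF that]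
      by (intro planar_bipartite_card_edges[where col=col]) (auto simp: verts_def edges_def)
    then show ?thesis by (simp add: verts_def edges_def)
  qed
  then have "(\<Sum>i<thickness G. card (Es i)) \<le> thickness G * (2 * card (verts G) - 4)"
    using sum_bounded_above[of "{..<thickness G}" "\<lambda>i. card (Es i)"] by simp
  then show ?thesis
    using card_UN_le[of "{..<thickness G}" Es] Es(1) by simp
qed

text \<open>Translating a drawing of \<open>G'\<close> far enough yields arbitrarily many disjoint copies of it;
  \<open>c\<close> tells in which copy a vertex is placed.\<close>

lemma planar_subgraph_of_copies:
  fixes G' :: "'b graph" and f :: "'a \<Rightarrow> 'b" and c :: "'a \<Rightarrow> nat"
  assumes G': "planar G'" "finite (verts G')"
    and f: "f ` V \<subseteq> verts G'" "inj_on (\<lambda>x. (f x, c x)) V"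
    and E: "\<And>e. e \<in> E \<Longrightarrow> \<exists>u v. e = {u, v} \<and> u \<in> V \<and> v \<in> V \<and> c u = c v \<and> {f u, f v} \<in> edges G'"
  shows "planar (V, E)"
proof -
  obtain p :: "'b \<Rightarrow> complex" and \<gamma> where p: "inj_on p (verts G')"
    and d: "\<forall>e\<in>edges G'. \<exists>u v. e = {u, v} \<and> u \<noteq> v \<and> u \<in> verts G' \<and> v \<in> verts G' \<and>
            arc (\<gamma> e) \<and> pathstart (\<gamma> e) = p u \<and> pathfinish (\<gamma> e) = p v \<and>
            path_image (\<gamma> e) \<inter> p ` verts G' = {p u, p v}"
    and cross: "\<forall>e\<in>edges G'. \<forall>e'\<in>edges G'. e \<noteq> e' \<longrightarrow>
            path_image (\<gamma> e) \<inter> path_image (\<gamma> e') \<subseteq> p ` (e \<inter> e')"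
    using G'(1) unfolding planar_def by blast
  have arcs: "arc (\<gamma> e)" "e \<subseteq> verts G'" if "e \<in> edges G'" for e
    using bspec[OF d that] by blast+
  then have "edges G' \<subseteq> Pow (verts G')" by blast
  then have "finite (edges G')" using G'(2) finite_subset by auto
  then have "bounded (p ` verts G' \<union> (\<Union>e\<in>edges G'. path_image (\<gamma> e)))" (is "bounded ?S")
    using G'(2) arcs(1)
    by (intro bounded_Un[THEN iffD2] conjI bounded_UN ballI) (auto intro: finite_imp_bounded bounded_arc_image)
  then have "\<exists>R>0. \<forall>z\<in>?S. norm z < R" by (simp only: bounded_pos_less)
  then obtain R where R: "R > 0" "\<And>z. z \<in> ?S \<Longrightarrow> norm z < R" by metis
  \<comment> \<open>The whole drawing lies in the open disc of radius \<open>R\<close> about 0, so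
    translates by different multiples of \<open>2 * R\<close> are disjoint.\<close>
  define D :: "nat \<Rightarrow> complex" where "D i = of_real (2 * R * real i)" for i
  have far: "i = j" if "norm w < R" "norm w' < R" "D i + w = D j + w'" for i j w w'
  proof (rule ccontr)
    assume "i \<noteq> j"
    then have "1 \<le> \<bar>real i - real j\<bar>" by linarith
    then have "2 * R \<le> 2 * R * \<bar>real i - real j\<bar>" using R(1) by simp
    also have "\<dots> = norm (D i - D j)"
      unfolding D_def of_real_diff[symmetric] norm_of_real using R(1)
      by (simp add: abs_mult flip: right_diff_distrib)
    also have "D i - D j = w' - w" using that(3) by algebra
    also have "norm (w' - w) < 2 * R" using norm_triangle_ineq4[of w' w] that by linarith
    finally show False by simp
  qed
  define q where "q x = D (c x) + p (f x)" for x
  \<comment> \<open>Both ends of an edge lie in the same copy, so it does not matter which end is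
    chosen.\<close>
  define ce where "ce e = c (SOME x. x \<in> e)" for e
  define \<delta> where "\<delta> e = (+) (D (ce e)) \<circ> \<gamma> (f ` e)" for e
  have fe: "f ` e \<in> edges G'" "e \<subseteq> V" "\<And>x. x \<in> e \<Longrightarrow> c x = ce e" if e: "e \<in> E" for e
  proof -
    obtain u v where uv: "e = {u, v}" "u \<in> V" "v \<in> V" "c u = c v" "{f u, f v} \<in> edges G'"
      using E[OF e] by blast
    then show "f ` e \<in> edges G'" "e \<subseteq> V" by auto
    have "(SOME x. x \<in> e) \<in> e" unfolding some_in_eq using uv(1) by blast
    then show "c x = ce e" if "x \<in> e" for x using that uv unfolding ce_def by auto
  qed
  have normp: "norm (p (f x)) < R" if "x \<in> V" for x using that f(1) by (intro R(2)) blast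
  have normg: "norm w < R" if "e \<in> E" "w \<in> path_image (\<gamma> (f ` e))" for e w
    using that fe(1) by (intro R(2)) blast
  have image: "path_image (\<delta> e) = (+) (D (ce e)) ` path_image (\<gamma> (f ` e))" for e
    by (simp add: \<delta>_def path_image_translation)
  have inj: "inj_on q V"
  proof (rule inj_onI)
    fix x y assume xy: "x \<in> V" "y \<in> V" "q x = q y"
    then have "c x = c y" using far normp unfolding q_def by blast
    moreover from this have "p (f x) = p (f y)" using xy(3) by (simp add: q_def)
    then have "f x = f y" using p f(1) xy by (meson image_subset_iff inj_onD)
    ultimately show "x = y" using f(2) xy by (simp add: inj_on_def)
  qed
  have edge: "\<exists>u v. e = {u, v} \<and> u \<noteq> v \<and> u \<in> V \<and> v \<in> V \<and> arc (\<delta> e) \<and> pathstart (\<delta> e) = q u \<and>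
      pathfinish (\<delta> e) = q v \<and> path_image (\<delta> e) \<inter> q ` V = {q u, q v}" if e: "e \<in> E" for e
  proof -
    obtain a b where ab: "f ` e = {a, b}" "a \<noteq> b" "arc (\<gamma> (f ` e))" "pathstart (\<gamma> (f ` e)) = p a"
      "pathfinish (\<gamma> (f ` e)) = p b" "path_image (\<gamma> (f ` e)) \<inter> p ` verts G' = {p a, p b}"
      using bspec[OF d fe(1)[OF e]] by blast
    obtain u v where uv: "u \<in> e" "v \<in> e" "a = f u" "b = f v" using ab(1) by blast
    then have V: "u \<in> V" "v \<in> V" "u \<noteq> v" using fe(2)[OF e] ab(2) by auto
    obtain u' v' where "e = {u', v'}" using E[OF e] by blast
    then have euv: "e = {u, v}" using uv V by auto
    have qu: "q u = D (ce e) + p a" "q v = D (ce e) + p b"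
      using uv fe(3)[OF e] by (auto simp: q_def)
    have "path_image (\<delta> e) \<inter> q ` V \<subseteq> {q u, q v}"
    proof
      fix z assume "z \<in> path_image (\<delta> e) \<inter> q ` V"
      then obtain w x where w: "w \<in> path_image (\<gamma> (f ` e))" "z = D (ce e) + w" "x \<in> V" "z = q x"
        unfolding image by blast
      then have "ce e = c x" using far normg[OF e] normp unfolding q_def by metis
      then have "w = p (f x)" using w by (simp add: q_def)
      then have "w \<in> {p a, p b}" using ab(6) w f(1) by blast
      then show "z \<in> {q u, q v}" using w(2) qu by auto
    qed
    moreover have "{q u, q v} \<subseteq> path_image (\<delta> e) \<inter> q ` V"
      unfolding image using imageI[OF V(1), of q] imageI[OF V(2), of q] qu ab(6) by auto
    moreover have "arc (\<delta> e)" "pathstart (\<delta> e) = q u" "pathfinish (\<delta> e) = q v"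
      using ab qu by (simp_all add: \<delta>_def arc_translation_eq pathstart_translation pathfinish_translation)
    ultimately show ?thesis using euv V by blast
  qed
  have "path_image (\<delta> e) \<inter> path_image (\<delta> e') \<subseteq> q ` (e \<inter> e')" if e: "e \<in> E" "e' \<in> E" "e \<noteq> e'" for e e'
  proof
    fix z assume "z \<in> path_image (\<delta> e) \<inter> path_image (\<delta> e')"
    then obtain w w' where w: "w \<in> path_image (\<gamma> (f ` e))" "z = D (ce e) + w"
      "w' \<in> path_image (\<gamma> (f ` e'))" "z = D (ce e') + w'"
      unfolding image by blast
    then have c: "ce e = ce e'" using far normg e by metis
    then have "w = w'" using w by simp
    have inj2: "x = y" if "x \<in> e" "y \<in> e'" "f x = f y" for x y
    proof -
      have "c x = c y" "x \<in> V" "y \<in> V" using fe e c that by auto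
      then show ?thesis using f(2) that(3) by (simp add: inj_on_def)
    qed
    \<comment> \<open>Both edges are now known to lie in one copy, where \<open>f\<close> is
      injective; distinct edges therefore come from distinct edges of \<open>G'\<close>.\<close>
    have "f ` e \<noteq> f ` e'"
    proof
      assume eq: "f ` e = f ` e'"
      have "e \<subseteq> e'"
      proof
        fix x assume x: "x \<in> e"
        then obtain y where "y \<in> e'" "f x = f y" using eq by blast
        then show "x \<in> e'" using inj2[OF x] by blast
      qed
      moreover have "e' \<subseteq> e"
      proof
        fix y assume y: "y \<in> e'"
        then obtain x where "x \<in> e" "f x = f y" using eq by (metis imageE imageI)
        then show "y \<in> e" using inj2[of x y] y by blast
      qed
      ultimately show False using e(3) by blast
    qed
    then have "w \<in> p ` (f ` e \<inter> f ` e')"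
      using cross fe(1) e w \<open>w = w'\<close> by blast
    then obtain s where s: "s \<in> f ` e" "s \<in> f ` e'" "w = p s" by blast
    then obtain x y where xy: "x \<in> e" "s = f x" "y \<in> e'" "s = f y" by blast
    then have "x \<in> e \<inter> e'" using inj2 by blast
    moreover have "z = q x" using w s xy fe(3)[OF e(1)] by (simp add: q_def)
    ultimately show "z \<in> q ` (e \<inter> e')" by blast
  qed
  then show ?thesis
    unfolding planar_def verts_def edges_def using inj edge
    by (intro exI[of _ q] exI[of _ \<delta>]) simp
qed

section \<open>The Kronecker product with \<open>K\<^sub>2\<close>\<close>

abbreviation tripartite_verts :: "nat \<Rightarrow> nat \<Rightarrow> nat \<Rightarrow> (nat \<times> nat) set" where
  "tripartite_verts l m n \<equiv> {0} \<times> {..<l} \<union> {1} \<times> {..<m} \<union> {2} \<times> {..<n}"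

lemma verts_K3part: "verts (K3part l m n) = tripartite_verts l m n"
  by (auto simp: K3part_def Let_def verts_def)

lemma verts_kron_K3part: "verts (kron (K3part l m n) K2) = tripartite_verts l m n \<times> {0, 1}"
  unfolding kron_def using verts_K3part[of l m n] by (simp add: verts_def K2_def)

lemma edges_K3part:
  "{x, y} \<in> edges (K3part l m n) \<longleftrightarrow>
    x \<in> tripartite_verts l m n \<and> y \<in> tripartite_verts l m n \<and> fst x \<noteq> fst y"
proof -
  have "{x, y} \<in> edges (K3part l m n) \<longleftrightarrow>
    x \<in> verts (K3part l m n) \<and> y \<in> verts (K3part l m n) \<and> fst x \<noteq> fst y"
    unfolding K3part_def Let_def verts_def edges_def fst_conv snd_conv mem_Collect_eq
    by (smt (verit) doubleton_eq_iff)
  then show ?thesis by (simp only: verts_K3part)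
qed

text \<open>Naming the end with second coordinate 0 first turns edges into ordered pairs of adjacent
  vertices, a form in which they can be counted.\<close>

lemma edges_kron_K3part:
  "edges (kron (K3part l m n) K2) = (\<lambda>(x, y). {(x, 0), (y, 1)}) `
    {(x, y) \<in> tripartite_verts l m n \<times> tripartite_verts l m n. fst x \<noteq> fst y}" (is "?L = ?f ` ?P")
proof (intro subset_antisym subsetI)
  fix e assume "e \<in> ?L"
  then obtain x h y h' where e: "e = {(x, h), (y, h')}" "{x, y} \<in> edges (K3part l m n)"
    "{h, h'} = {0, 1}"
    by (auto simp: kron_def edges_def K2_def)
  have P: "(x, y) \<in> ?P" "(y, x) \<in> ?P" using e(2) unfolding edges_K3part by auto
  have "h = 0 \<and> h' = 1 \<or> h = 1 \<and> h' = 0" using e(3) by (simp add: doubleton_eq_iff)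
  then have "e = ?f (x, y) \<or> e = ?f (y, x)" using e(1) by auto
  then show "e \<in> ?f ` ?P"
    using imageI[OF P(1), of ?f] imageI[OF P(2), of ?f] by (elim disjE) (simp_all only:)
next
  fix e assume "e \<in> ?f ` ?P"
  then obtain x y where "e = {(x, 0), (y, 1)}" "{x, y} \<in> edges (K3part l m n)"
    unfolding edges_K3part by auto
  moreover have "{0, 1} \<in> edges K2" by (simp add: K2_def edges_def)
  ultimately have "\<exists>g h g' h'. e = {(g, h), (g', h')} \<and> {g, g'} \<in> edges (K3part l m n) \<and> {h, h'} \<in> edges K2"
    by blast
  then show "e \<in> ?L" unfolding kron_def by (simp add: edges_def)
qed

lemma card_tripartite_verts: "card (tripartite_verts l m n) = l + m + n"
  by (subst card_Un_disjoint; auto simp: card_cartesian_product)+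

lemma card_edges_kron_K3part: "card (edges (kron (K3part l m n) K2)) = 2 * (l*m + l*n + m*n)"
proof -
  let ?A = "{0::nat} \<times> {..<l}" and ?B = "{1::nat} \<times> {..<m}" and ?C = "{2::nat} \<times> {..<n}"
  let ?P = "{(x, y) \<in> tripartite_verts l m n \<times> tripartite_verts l m n. fst x \<noteq> fst y}"
  have "?P = ?A \<times> (?B \<union> ?C) \<union> (?B \<times> (?A \<union> ?C) \<union> ?C \<times> (?A \<union> ?B))"
    by auto
  moreover have "card (?A \<times> (?B \<union> ?C) \<union> (?B \<times> (?A \<union> ?C) \<union> ?C \<times> (?A \<union> ?B)))
    = card ?A * card (?B \<union> ?C) + (card ?B * card (?A \<union> ?C) + card ?C * card (?A \<union> ?B))"
    by (subst card_Un_disjoint; (force | subst card_Un_disjoint)?; force simp: card_cartesian_product)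
  moreover have "card (?B \<union> ?C) = m + n" "card (?A \<union> ?C) = l + n" "card (?A \<union> ?B) = l + m"
    by (subst card_Un_disjoint; auto simp: card_cartesian_product)+
  ultimately have "card ?P = 2 * (l*m + l*n + m*n)" by (simp add: algebra_simps)
  moreover have "inj_on (\<lambda>(x, y). {(x, 0), (y, 1::nat)}) ?P"
    by (auto simp: inj_on_def doubleton_eq_iff)
  ultimately show ?thesis unfolding edges_kron_K3part by (simp only: card_image)
qed

lemma edge_kron_K3partE:
  assumes "e \<in> edges (kron (K3part l m n) K2)"
  obtains x y where "e = {(x, 0), (y, 1)}" "x \<in> tripartite_verts l m n" "y \<in> tripartite_verts l m n"
    "fst x \<noteq> fst y"
  using assms unfolding edges_kron_K3part by blast

section \<open>The lower bound\<close>

lemma thickness_kron_K3part_lower: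
  assumes "1 \<le> l" "1 \<le> m" "1 \<le> n"
  shows "l*m + l*n + m*n \<le> thickness (kron (K3part l m n) K2) * (2 * (l + m + n) - 2)"
proof -
  let ?K = "kron (K3part l m n) K2"
  have V: "finite (verts ?K)" "card (verts ?K) = 2 * (l + m + n)"
    unfolding verts_kron_K3part card_cartesian_product card_tripartite_verts by simp_all
  have "card (edges ?K) \<le> thickness ?K * (2 * card (verts ?K) - 4)"
  \<comment> \<open>The product with \<open>K2\<close> is bipartite, coloured by its second
    coordinate.\<close>
  proof (rule bipartite_card_edges_le_thickness[where col="\<lambda>x. snd x = 0"])
    fix e assume "e \<in> edges ?K"
    then obtain x y where "e = {(x, 0), (y, 1)}" "x \<in> tripartite_verts l m n" "y \<in> tripartite_verts l m n"
      by (rule edge_kron_K3partE)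
    then show "\<exists>u v. e = {u, v} \<and> u \<noteq> v \<and> u \<in> verts ?K \<and> v \<in> verts ?K"
      unfolding verts_kron_K3part by (intro exI[of _ "(x, 0)"] exI[of _ "(y, 1)"]) simp
  next
    fix u v :: "(nat \<times> nat) \<times> nat" assume "{u, v} \<in> edges ?K"
    then obtain x y where "{u, v} = {(x, 0), (y, 1)}" by (rule edge_kron_K3partE)
    then show "(snd u = 0) \<noteq> (snd v = 0)" by (auto simp: doubleton_eq_iff)
  qed (use V assms in auto)
  then have "2 * (l*m + l*n + m*n) \<le> thickness ?K * (2 * (2 * (l + m + n)) - 4)"
    unfolding V(2) card_edges_kron_K3part .
  \<comment> \<open>The doubled edge count and the doubled vertex count share a factor 2, which
    cancels.\<close>
  also have "2 * (2 * (l + m + n)) - 4 = 2 * (2 * (l + m + n) - 2)" by simp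
  finally show ?thesis by simp
qed

section \<open>The upper bound\<close>

text \<open>Write \<open>A\<close>, \<open>B\<close>, \<open>C\<close> for the parts of \<open>K3part\<close>, of sizes \<open>l\<close>, \<open>m\<close>, \<open>n\<close>. For \<open>b = 1\<close> the product
  contains the disjoint bipartite graphs on \<open>A0 B1\<close>, \<open>B0 C1\<close>, \<open>C0 A1\<close>, and for \<open>b = 0\<close> those on
  \<open>A0 C1\<close>, \<open>B0 A1\<close>, \<open>C0 B1\<close>. Each embeds into \<open>K2part m n\<close>: \<open>copy_index b\<close> numbers them by their \<open>0\<close>-side,
  and \<open>embed_K2part b\<close> embeds them, placing \<open>A\<close> in the first and \<open>C\<close> in the second part.\<close>

definition copy_index :: "nat \<Rightarrow> (nat \<times> nat) \<times> nat \<Rightarrow> nat" where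
  "copy_index b = (\<lambda>((i, j), h). if h = 0 then i else (i + 1 + b) mod 3)"

definition embed_K2part :: "nat \<Rightarrow> (nat \<times> nat) \<times> nat \<Rightarrow> nat \<times> nat" where
  "embed_K2part b = (\<lambda>((i, j), h). (if i = 2 \<or> i = 1 \<and> h = b then 1 else 0, j))"

lemma verts_K2part: "verts (K2part m n) = {0} \<times> {..<m} \<union> {1} \<times> {..<n}"
  by (auto simp: K2part_def Let_def verts_def)

lemma edges_K2part: "edges (K2part m n) =
    {{x, y} | x y. x \<in> verts (K2part m n) \<and> y \<in> verts (K2part m n) \<and> fst x \<noteq> fst y}"
  by (simp add: K2part_def Let_def verts_def edges_def)

text \<open>The first part of \<open>K2part m n\<close> receives \<open>A\<close> or
  \<open>B\<close>, which fit since \<open>l \<le> m\<close>; the second receives \<open>B\<close>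
  or \<open>C\<close>, which fit since \<open>m \<le> n\<close>.\<close>

lemma embed_in_K2part:
  assumes "l \<le> m" "m \<le> n" "x \<in> verts (kron (K3part l m n) K2)"
  shows "embed_K2part b x \<in> verts (K2part m n)"
  using assms unfolding verts_kron_K3part verts_K2part by (auto simp: embed_K2part_def split: if_splits)

text \<open>Each copy has one part at level 0 and one at level 1. These go to different parts of
  \<open>K2part\<close>, and the index within a part is kept.\<close>

lemma inj_on_embed_K2part_copy_index:
  assumes "b < 2"
  shows "inj_on (\<lambda>x. (embed_K2part b x, copy_index b x)) (verts (kron (K3part l m n) K2))"
proof -
  have "b = 0 \<or> b = 1" using assms by linarith
  then show ?thesis
    unfolding verts_kron_K3part inj_on_def
    by (elim disjE) (auto simp: embed_K2part_def copy_index_def split: if_splits)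
qed

lemma fst_embed_edge:
  assumes "i \<in> {0, 1, 2}" "i' \<in> {0, 1, 2}" "i \<noteq> i'"
  obtains b where "b < 2" "copy_index b ((i, j), 0) = copy_index b ((i', j'), 1)"
    "fst (embed_K2part b ((i, j), 0)) \<noteq> fst (embed_K2part b ((i', j'), 1))"
proof -
  have "\<exists>b<2. copy_index b ((i, j), 0) = copy_index b ((i', j'), 1) \<and>
    fst (embed_K2part b ((i, j), 0)) \<noteq> fst (embed_K2part b ((i', j'), 1))"
    using assms
    \<comment> \<open>The copies agree when \<open>i\<close> equals \<open>i' + 1 + b\<close> modulo
      3. For \<open>b = 1\<close> this says that \<open>i'\<close> is the cyclic successor of
      \<open>i\<close>; \<open>b = 0\<close> covers the other part.\<close>
    by (intro exI[of _ "if i' = (i + 1) mod 3 then 1 else 0"]) (auto simp: copy_index_def embed_K2part_def)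
  then show thesis using that by blast
qed

lemma thickness_kron_K3part_upper:
  assumes "l \<le> m" "m \<le> n"
  shows "thickness (kron (K3part l m n) K2) \<le> 2 * thickness (K2part m n)"
proof -
  let ?K = "kron (K3part l m n) K2" and ?H = "K2part m n"
  let ?k = "thickness ?H"
  have finH: "finite (verts ?H)" by (simp add: verts_K2part)
  have wf: "\<exists>u v. e = {u, v} \<and> u \<noteq> v \<and> u \<in> verts ?H \<and> v \<in> verts ?H" if "e \<in> edges ?H" for e
    using that unfolding edges_K2part by blast
  obtain Es where Es: "(\<Union>i<?k. Es i) = edges ?H" "\<And>i. i < ?k \<Longrightarrow> planar (verts ?H, Es i)"
    using thickness_decomposition[OF finH wf] by blast
  \<comment> \<open>\<open>Fs b i\<close> is the layer \<open>Es i\<close> of \<open>K2part\<close>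
    pulled back to the three copies belonging to \<open>b\<close>.\<close>
  define Fs where "Fs b i = {e \<in> edges ?K. \<exists>u v. e = {u, v} \<and> u \<in> verts ?K \<and> v \<in> verts ?K \<and>
      copy_index b u = copy_index b v \<and> {embed_K2part b u, embed_K2part b v} \<in> Es i}" for b i
  have planar: "planar (verts ?K, Fs b i)" if "b < 2" "i < ?k" for b i
  proof (rule planar_subgraph_of_copies[OF Es(2)[OF that(2)]])
    show "embed_K2part b ` verts ?K \<subseteq> verts (verts ?H, Es i)"
      using embed_in_K2part[OF assms] by (auto simp: verts_def)
    show "inj_on (\<lambda>x. (embed_K2part b x, copy_index b x)) (verts ?K)"
      using inj_on_embed_K2part_copy_index[OF that(1)] .
  qed (use finH in \<open>auto simp: verts_def edges_def Fs_def\<close>)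
  have "\<exists>b<2. \<exists>i<?k. e \<in> Fs b i" if e: "e \<in> edges ?K" for e
  proof -
    obtain x y where xy: "e = {(x, 0), (y, 1)}" "x \<in> tripartite_verts l m n" "y \<in> tripartite_verts l m n"
      "fst x \<noteq> fst y"
      using e by (rule edge_kron_K3partE)
    obtain i j i' j' where ij: "x = (i, j)" "y = (i', j')" by (meson surj_pair)
    have "i \<in> {0, 1, 2}" "i' \<in> {0, 1, 2}" "i \<noteq> i'" using xy ij by auto
    then obtain b where b: "b < 2" "copy_index b (x, 0) = copy_index b (y, 1)"
      "fst (embed_K2part b (x, 0)) \<noteq> fst (embed_K2part b (y, 1))"
      unfolding ij by (rule fst_embed_edge)
    have V: "(x, 0) \<in> verts ?K" "(y, 1) \<in> verts ?K"
      using xy unfolding verts_kron_K3part by auto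
    then have "{embed_K2part b (x, 0), embed_K2part b (y, 1)} \<in> edges ?H"
      unfolding edges_K2part using embed_in_K2part[OF assms] b(3) by blast
    then obtain r where "r < ?k" "{embed_K2part b (x, 0), embed_K2part b (y, 1)} \<in> Es r" using Es(1) by blast
    then have "e \<in> Fs b r" using e xy(1) V b unfolding Fs_def by blast
    with b \<open>r < ?k\<close> show ?thesis by blast
  qed
  then have cover: "edges ?K \<subseteq> (\<Union>b<2. \<Union>i<?k. Fs b i)" by blast
  show ?thesis
  proof (rule thickness_le)
    \<comment> \<open>The pairs of \<open>b < 2\<close> and \<open>i < ?k\<close> are numbered by
      \<open>b * ?k + i\<close>, which division and remainder decode.\<close>
    let ?F = "\<lambda>r. Fs (r div ?k) (r mod ?k)"
    show "(\<Union>r<2 * ?k. ?F r) = edges ?K"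
    proof
      show "(\<Union>r<2 * ?k. ?F r) \<subseteq> edges ?K" by (auto simp: Fs_def)
      show "edges ?K \<subseteq> (\<Union>r<2 * ?k. ?F r)"
      proof
        fix e assume "e \<in> edges ?K"
        then obtain b i where bi: "b < 2" "i < ?k" "e \<in> Fs b i" using cover by blast
        then have "b = 0 \<or> b = 1" by linarith
        then have "b * ?k + i < 2 * ?k" using bi(2) by auto
        moreover have "e \<in> ?F (b * ?k + i)" using bi by simp
        ultimately show "e \<in> (\<Union>r<2 * ?k. ?F r)" by blast
      qed
    qed
    fix r assume r: "r < 2 * ?k"
    then have "?k > 0" by (cases "?k = 0") auto
    then show "planar (verts ?K, ?F r)"
      using r by (intro planar) (simp_all add: less_mult_imp_div_less)
  qed
qed

theorem theorem4p1:
  fixes l m n :: nat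
  assumes "1 \<le> l" and "l \<le> m" and "m \<le> n"
  shows "\<lceil>real (l*m + l*n + m*n) / (2 * real (l + m + n) - 2)\<rceil>
           \<le> int (thickness (kron (K3part l m n) K2)) \<and>
         thickness (kron (K3part l m n) K2) \<le> 2 * thickness (K2part m n)"
proof
  let ?t = "thickness (kron (K3part l m n) K2)"
  have "l*m + l*n + m*n \<le> ?t * (2 * (l + m + n) - 2)"
    using assms by (intro thickness_kron_K3part_lower) auto
  then have "real (l*m + l*n + m*n) \<le> real (?t * (2 * (l + m + n) - 2))"
    by (rule of_nat_mono)
  \<comment> \<open>All parts are nonempty, so the subtraction of natural numbers is not truncated
    and agrees with the real one.\<close>
  also have "\<dots> = real ?t * (2 * real (l + m + n) - 2)"
    using assms by simp
  finally have "real (l*m + l*n + m*n) / (2 * real (l + m + n) - 2) \<le> real ?t"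
    using assms by (subst pos_divide_le_eq) auto
  then show "\<lceil>real (l*m + l*n + m*n) / (2 * real (l + m + n) - 2)\<rceil> \<le> int ?t"
    by (simp add: ceiling_le_iff)
  show "?t \<le> 2 * thickness (K2part m n)"
    using assms by (intro thickness_kron_K3part_upper)
qed

end
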